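(* For an integer $n \geq 1$ let $X_n = \{1, 2, \ldots, n\}$ and $maxSum(n) = \frac{n(n+1)}{2}$. For integers $S$ and $e$, let $SD[n][S]$ denote the number of subsets $A \subseteq X_n$ with $\sum_{a \in A} a = S$, and let $ED[n][S][e]$ denote the number of subsets $A \subseteq X_n$ with $\sum_{a \in A} a = S$ and $e \in A$. If $S$ is an integer with $\frac{n(n-1)}{2} + 1 \leq S \leq \frac{n(n+1)}{2}$ and $e$ is an integer with $1 \leq e < n$, then $$ED[n][S][e] = SD[n][S] - ED[n][maxSum(n) - S][e].$$
   Context: Subsets include the empty set, whose sum is taken to be $0$. *)

theory Defs
  imports Main
begin

definition X :: "int \<Rightarrow> int set" where
  "X n = {1..n}"

(* n * (n + 1) is even, so the integer division is exact. *)
definition maxSum :: "int \<Rightarrow> int" where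
  "maxSum n = n * (n + 1) div 2"

definition SD :: "int \<Rightarrow> int \<Rightarrow> nat" where
  "SD n S = card {A. A \<subseteq> X n \<and> (\<Sum>a\<in>A. a) = S}"

definition ED :: "int \<Rightarrow> int \<Rightarrow> int \<Rightarrow> nat" where
  "ED n S e = card {A. A \<subseteq> X n \<and> (\<Sum>a\<in>A. a) = S \<and> e \<in> A}"

end

theory Submission
  imports Defs
begin

definition subsets_with_sum :: "('a \<Rightarrow> 'b::ab_group_add) \<Rightarrow> 'a set \<Rightarrow> 'b \<Rightarrow> 'a set set" where
  "subsets_with_sum f B s = {A. A \<subseteq> B \<and> sum f A = s}"

lemma finite_subsets_with_sum: "finite B \<Longrightarrow> finite (subsets_with_sum f B s)"
  by (simp add: subsets_with_sum_def)

lemma Diff_in_subsets_with_sum_iff: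
  assumes "finite B" "A \<subseteq> B"
  shows "B - A \<in> subsets_with_sum f B s \<longleftrightarrow> A \<in> subsets_with_sum f B (sum f B - s)"
  using assms by (auto simp: subsets_with_sum_def sum_diff algebra_simps)

lemma bij_betw_Diff_subsets_with_sum:
  assumes "finite B" "x \<in> B"
  shows "bij_betw (\<lambda>A. B - A)
           {A \<in> subsets_with_sum f B (sum f B - s). x \<in> A}
           {A \<in> subsets_with_sum f B s. x \<notin> A}"
    (is "bij_betw _ ?with ?without")
proof (rule bij_betw_byWitness[where f' = "\<lambda>A. B - A"])
  have subset: "A \<subseteq> B" if "A \<in> subsets_with_sum f B t" for A t
    using that by (simp add: subsets_with_sum_def)
  show "\<forall>A\<in>?with. B - (B - A) = A" "\<forall>A\<in>?without. B - (B - A) = A"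
    using subset double_diff by blast+
  show "(\<lambda>A. B - A) ` ?with \<subseteq> ?without" "(\<lambda>A. B - A) ` ?without \<subseteq> ?with"
    using assms subset by (auto simp: Diff_in_subsets_with_sum_iff)
qed

lemma card_subsets_with_sum_eq_add:
  assumes "finite B" "x \<in> B"
  shows "card (subsets_with_sum f B s) =
    card {A \<in> subsets_with_sum f B s. x \<in> A} +
    card {A \<in> subsets_with_sum f B (sum f B - s). x \<in> A}"
proof -
  let ?F = "subsets_with_sum f B s"
  have "card ?F = card (?F \<inter> {A. x \<in> A}) + card (?F - {A. x \<in> A})"
    using assms(1) by (intro card_Int_Diff finite_subsets_with_sum)
  also have "?F \<inter> {A. x \<in> A} = {A \<in> ?F. x \<in> A}"
    by blast
  also have "?F - {A. x \<in> A} = {A \<in> ?F. x \<notin> A}"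
    by blast
  also have "card {A \<in> ?F. x \<notin> A} = card {A \<in> subsets_with_sum f B (sum f B - s). x \<in> A}"
    using bij_betw_same_card[OF bij_betw_Diff_subsets_with_sum[OF assms]] by (rule sym)
  finally show ?thesis .
qed

lemma SD_eq_card_subsets_with_sum: "SD n S = card (subsets_with_sum (\<lambda>a. a) (X n) S)"
  by (simp add: SD_def subsets_with_sum_def)

lemma ED_eq_card_subsets_with_sum:
  "ED n S e = card {A \<in> subsets_with_sum (\<lambda>a. a) (X n) S. e \<in> A}"
  by (simp add: ED_def subsets_with_sum_def conj_assoc)

lemma sum_X:
  assumes "n \<ge> 0"
  shows "(\<Sum>a\<in>X n. a) = maxSum n"
proof (cases "n = 0")
  case False
  with assms show ?thesis
    by (simp add: X_def maxSum_def Sum_Icc_int)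
qed (simp add: X_def maxSum_def)

theorem theorem4:
  fixes n S e :: int
  assumes "n \<ge> 1"
    and "n * (n - 1) div 2 + 1 \<le> S" and "S \<le> n * (n + 1) div 2"
    and "1 \<le> e" and "e < n"
  shows "int (ED n S e) = int (SD n S) - int (ED n (maxSum n - S) e)"
proof -
  have "finite (X n)" "e \<in> X n"
    using assms by (simp_all add: X_def)
  from card_subsets_with_sum_eq_add[OF this, of "\<lambda>a. a" S]
  have "SD n S = ED n S e + ED n (maxSum n - S) e"
    using assms(1) by (simp add: SD_eq_card_subsets_with_sum ED_eq_card_subsets_with_sum sum_X)
  then show ?thesis
    by simp
qed

end
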